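(* Non-generic ordered right-angled hexagons of type 3 in the Siegel space of $\mathrm{Sp}(4,\mathbb R)$ are parametrized up to isometry by $$\mathcal H^{nongen}_{type3}/\mathrm{PSp}(4,\mathbb R)\cong\mathfrak d^3\cong\mathbb R^3_{>0};$$ that is, the map $[(P,A,B,C,D,Q)]\mapsto(\underline b,\underline c,\underline d)\in\mathfrak d^3$ given by the length parameters is a bijection.
   Context: $\mathrm{PSp}(4,\mathbb R)=\mathrm{Sp}(4,\mathbb R)/\{\pm\mathrm{Id}\}$ where $\mathrm{Sp}(4,\mathbb R)$ preserves the form with matrix $\begin{pmatrix}0&\mathrm{Id}\\-\mathrm{Id}&0\end{pmatrix}$. A real symmetric matrix $X$ denotes the Lagrangian of $\mathbb R^4$ spanned by the columns of $\binom{X}{\mathrm{Id}}$, and $\infty=\langle e_1,e_2\rangle$. A triple of pairwise transverse Lagrangians is maximal if it is in the $\mathrm{Sp}(4,\mathbb R)$-orbit of $(\infty,0,\mathrm{Id})$ (so $(\infty,X,Y)$ is maximal iff $Y-X$ is positive definite); an $m$-tuple is maximal if all its subtriples with increasing indices are. Cross-ratio: $R(l_1,l_2,l_3,l_4)=p_{l_1}^{\|l_2}\circ p_{l_4}^{\|l_3}|_{l_1}$, where $p_l^{\|l'}$ is the projection to $l$ parallel to $l'$ (e.g. $R(0,Z,X,\infty)=Z^{-1}X$). A maximal quadruple $(P,X,Y,Q)$ is non-generic if the two eigenvalues of $R(P,X,Y,Q)$ are equal. An ordered right-angled hexagon (a cyclic sequence of six consecutively orthogonal $\mathbb R$-tubes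 of the Siegel space with a chosen first tube) is uniquely determined by, and identified with, a maximal 6-tuple $(P,A,B,C,D,Q)$ of Lagrangians. $\mathcal H^{nongen}_{type3}$ is the set of maximal $(P,A,B,C,D,Q)$ such that $(P,A,B,Q)$, $(P,B,C,Q)$, $(P,C,D,Q)$ are all non-generic. Length parameters: for a maximal quadruple $(P,X,Y,Q)$ the Weyl-chamber-valued distance between the orthogonal projections of $X$ and $Y$ to the tube $\mathcal Y_{P,Q}$ is $(\log\mu_1,\log\mu_2)$ with $\mu_1\ge\mu_2$ the eigenvalues of $R(P,X,Y,Q)$; $\underline b,\underline c,\underline d$ are these vectors for $(P,A,B,Q)$, $(P,B,C,Q)$, $(P,C,D,Q)$ respectively. $\mathfrak d=\{(x_1,x_2):x_1=x_2>0\}$. *)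

theory Defs
  imports "HOL-Analysis.Analysis" "HOL-Algebra.Group_Action"
begin

subsection \<open>The symplectic group and its projectivization\<close>

definition J4 :: "real^4^4" where
  "J4 = vector [vector [ 0,  0, 1, 0],
                vector [ 0,  0, 0, 1],
                vector [-1,  0, 0, 0],
                vector [ 0, -1, 0, 0]]"

definition Sp4 :: "(real^4^4) monoid" where
  "Sp4 = \<lparr>carrier = {g. transpose g ** J4 ** g = J4}, mult = (**), one = mat 1\<rparr>"

definition PSp4 :: "(real^4^4) set monoid" where
  "PSp4 = Sp4 Mod {mat 1, - mat 1}"


subsection \<open>Lagrangians and maximality\<close>

type_synonym plane = "(real^4) set"

definition lagrangian :: "plane \<Rightarrow> bool" where
  "lagrangian l \<longleftrightarrow> subspace l \<and> dim l = 2 \<and> (\<forall>u\<in>l. \<forall>v\<in>l. u \<bullet> (J4 *v v) = 0)"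

definition transverse :: "plane \<Rightarrow> plane \<Rightarrow> bool" where
  "transverse l l' \<longleftrightarrow> l \<inter> l' = {0}"

definition lag_infty :: plane where
  "lag_infty = span {axis 1 1, axis 2 1}"

text \<open>The span of the columns of the block matrix with \<open>X\<close> above the identity;
  \<open>vector\<close> lists the rows of this matrix with 4 rows and 2 columns.\<close>

definition lag_of :: "real^2^2 \<Rightarrow> plane" where
  "lag_of X = span (columns (vector [X $ 1, X $ 2, mat 1 $ 1, mat 1 $ 2] :: real^2^4))"

definition maximal_triple :: "plane \<Rightarrow> plane \<Rightarrow> plane \<Rightarrow> bool" where
  "maximal_triple l1 l2 l3 \<longleftrightarrow>
     lagrangian l1 \<and> lagrangian l2 \<and> lagrangian l3 \<and>
     transverse l1 l2 \<and> transverse l1 l3 \<and> transverse l2 l3 \<and>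
     (\<exists>g\<in>carrier Sp4. l1 = (*v) g ` lag_infty \<and> l2 = (*v) g ` lag_of 0 \<and>
        l3 = (*v) g ` lag_of (mat 1))"

definition maximal_tuple :: "plane list \<Rightarrow> bool" where
  "maximal_tuple ls \<longleftrightarrow>
     (\<forall>i j k. i < j \<and> j < k \<and> k < length ls \<longrightarrow> maximal_triple (ls ! i) (ls ! j) (ls ! k))"


subsection \<open>Cross-ratio, non-genericity and length parameters\<close>

text \<open>The projection to \<open>l\<close> parallel to \<open>l'\<close>; meaningful for transverse Lagrangians.\<close>

definition proj_par :: "plane \<Rightarrow> plane \<Rightarrow> real^4 \<Rightarrow> real^4" where
  "proj_par l l' v = (THE w. w \<in> l \<and> v - w \<in> l')"

definition cross_ratio :: "plane \<Rightarrow> plane \<Rightarrow> plane \<Rightarrow> plane \<Rightarrow> real^4 \<Rightarrow> real^4" where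
  "cross_ratio l1 l2 l3 l4 = restrict (proj_par l1 l2 \<circ> proj_par l4 l3) l1"

text \<open>\<open>\<mu>\<close> and \<open>\<nu>\<close> are the two eigenvalues, with algebraic multiplicity, of the endomorphism
  \<open>f\<close> of the plane \<open>l\<close>: the columns of \<open>B\<close> form a basis of \<open>l\<close>, the matrix of \<open>f\<close> in this
  basis is \<open>M\<close>, and the characteristic polynomial of \<open>M\<close> has the roots \<open>\<mu>\<close> and \<open>\<nu>\<close>.\<close>

definition eigenvalue_pair :: "plane \<Rightarrow> (real^4 \<Rightarrow> real^4) \<Rightarrow> real \<Rightarrow> real \<Rightarrow> bool" where
  "eigenvalue_pair l f \<mu> \<nu> \<longleftrightarrow>
     (\<exists>(B :: real^2^4) (M :: real^2^2).
        inj ((*v) B) \<and> range ((*v) B) = l \<and>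
        (\<forall>x. f (B *v x) = B *v (M *v x)) \<and>
        (\<forall>t. det (mat t - M) = (t - \<mu>) * (t - \<nu>)))"

definition nongeneric :: "plane \<Rightarrow> plane \<Rightarrow> plane \<Rightarrow> plane \<Rightarrow> bool" where
  "nongeneric P X Y Q \<longleftrightarrow>
     maximal_tuple [P, X, Y, Q] \<and> (\<exists>\<mu>. eigenvalue_pair P (cross_ratio P X Y Q) \<mu> \<mu>)"

text \<open>The Weyl-chamber-valued distance between the orthogonal projections of \<open>X\<close> and \<open>Y\<close> to
  the tube of \<open>P\<close> and \<open>Q\<close>, expressed through the cross-ratio. For a maximal quadruple the two
  eigenvalues are real, positive and unique up to order, so the description is proper.\<close>

definition length_vec :: "plane \<Rightarrow> plane \<Rightarrow> plane \<Rightarrow> plane \<Rightarrow> real \<times> real" where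
  "length_vec P X Y Q =
     (THE v. \<exists>\<mu>1 \<mu>2. \<mu>1 \<ge> \<mu>2 \<and> eigenvalue_pair P (cross_ratio P X Y Q) \<mu>1 \<mu>2 \<and>
        v = (ln \<mu>1, ln \<mu>2))"


subsection \<open>Hexagons\<close>

text \<open>An ordered right-angled hexagon is identified with a maximal 6-tuple
  \<open>(P, A, B, C, D, Q)\<close>.\<close>

type_synonym hexagon = "plane \<times> plane \<times> plane \<times> plane \<times> plane \<times> plane"

definition H_nongen_type3 :: "hexagon set" where
  "H_nongen_type3 = {(P, A, B, C, D, Q).
     maximal_tuple [P, A, B, C, D, Q] \<and>
     nongeneric P A B Q \<and> nongeneric P B C Q \<and> nongeneric P C D Q}"

text \<open>An element of \<open>PSp4\<close> is a coset \<open>{g, - g}\<close>. As \<open>g\<close> and \<open>- g\<close> map a subspace to the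
  same subspace, the union below is the image under either representative.\<close>

definition PSp4_act :: "(real^4^4) set \<Rightarrow> plane \<Rightarrow> plane" where
  "PSp4_act K l = (\<Union>g\<in>K. (*v) g ` l)"

definition PSp4_act_hex :: "(real^4^4) set \<Rightarrow> hexagon \<Rightarrow> hexagon" where
  "PSp4_act_hex K = (\<lambda>(P, A, B, C, D, Q).
     (PSp4_act K P, PSp4_act K A, PSp4_act K B, PSp4_act K C, PSp4_act K D, PSp4_act K Q))"

definition length_params :: "hexagon \<Rightarrow> (real \<times> real) \<times> (real \<times> real) \<times> (real \<times> real)" where
  "length_params = (\<lambda>(P, A, B, C, D, Q).
     (length_vec P A B Q, length_vec P B C Q, length_vec P C D Q))"

definition diag_chamber :: "(real \<times> real) set" where
  "diag_chamber = {(x1, x2). x1 = x2 \<and> x1 > 0}"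

end

theory Submission
  imports Defs
begin

text \<open>Move \<open>(P, A, Q)\<close> to \<open>(0, Id, \<infinity>)\<close> by a symplectic map. If \<open>A = a Id\<close>
  with \<open>a > 0\<close> and \<open>B\<close> is the Lagrangian of a symmetric matrix \<open>X\<close>, then \<open>R(0, A, X, \<infinity>)\<close> is
  \<open>X / a\<close>, which is diagonalizable; so non-genericity forces \<open>X = a b Id\<close>, and maximality of
  \<open>(A, B, \<infinity>)\<close> says \<open>b > 1\<close>. Going through \<open>B\<close>, \<open>C\<close>, \<open>D\<close> in turn, every hexagon is equivalent to
  \<open>(0, 1, b, b c, b c d, \<infinity>)\<close> with \<open>b, c, d > 1\<close>, whose length parameters are
  \<open>ln b\<close>, \<open>ln c\<close>, \<open>ln d\<close> (each doubled). As the cross-ratio is equivariant, these are invariants.\<close>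

lemma vector_4 [simp]:
  "(vector [x, y, z, w] :: ('a::zero)^4) $ 1 = x"
  "(vector [x, y, z, w] :: ('a::zero)^4) $ 2 = y"
  "(vector [x, y, z, w] :: ('a::zero)^4) $ 3 = z"
  "(vector [x, y, z, w] :: ('a::zero)^4) $ 4 = w"
  unfolding vector_def by simp_all

lemma J4_form: "u \<bullet> (J4 *v v) = u $ 1 * v $ 3 + u $ 2 * v $ 4 - u $ 3 * v $ 1 - u $ 4 * v $ 2"
  by (simp add: J4_def inner_vec_def sum_4 matrix_vector_mult_def)

subsection \<open>The symplectic group\<close>

lemma Sp4_form:
  assumes "g \<in> carrier Sp4"
  shows "(g *v u) \<bullet> (J4 *v (g *v v)) = u \<bullet> (J4 *v v)"
proof -
  have "(g *v u) \<bullet> (J4 *v (g *v v)) = u \<bullet> ((transpose g ** J4 ** g) *v v)"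
    by (metis dot_lmul_matrix matrix_vector_mul_assoc vector_transpose_matrix)
  then show ?thesis using assms by (simp add: Sp4_def)
qed

lemma Sp4_mult:
  assumes "g \<in> carrier Sp4" "h \<in> carrier Sp4"
  shows "g ** h \<in> carrier Sp4"
proof -
  have "transpose (g ** h) ** J4 ** (g ** h) = transpose h ** (transpose g ** J4 ** g) ** h"
    by (simp add: matrix_transpose_mul matrix_mul_assoc)
  then show ?thesis using assms by (simp add: Sp4_def)
qed

lemma Sp4_one: "mat 1 \<in> carrier Sp4"
  by (simp add: Sp4_def)

lemma J4_left_inverse: "(- J4) ** J4 = mat 1"
  by (simp add: J4_def matrix_matrix_mult_def mat_def vec_eq_iff forall_4 sum_4)

lemma Sp4_inverse:
  assumes "g \<in> carrier Sp4"
  obtains h where "h \<in> carrier Sp4" "h ** g = mat 1" "g ** h = mat 1"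
proof -
  \<comment> \<open>Since \<open>- J4\<close> is the inverse of \<open>J4\<close>, the relation
    \<open>transpose g ** J4 ** g = J4\<close> can be solved for the inverse of
    \<open>g\<close>.\<close>
  define h where "h = (- J4) ** transpose g ** J4"
  have "h ** g = (- J4) ** (transpose g ** J4 ** g)"
    by (simp add: h_def matrix_mul_assoc)
  also have "\<dots> = mat 1"
    using assms J4_left_inverse by (simp add: Sp4_def)
  finally have hg: "h ** g = mat 1" .
  then have gh: "g ** h = mat 1"
    by (simp add: matrix_left_right_inverse)
  \<comment> \<open>Replacing the inner \<open>J4\<close> by \<open>transpose g ** J4 ** g\<close>
    exhibits the product as a congruence by \<open>g ** h\<close>, which is the identity.\<close>
  have "transpose h ** J4 ** h = transpose h ** (transpose g ** J4 ** g) ** h"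
    using assms by (simp add: Sp4_def)
  also have "\<dots> = transpose (g ** h) ** J4 ** (g ** h)"
    by (simp add: matrix_transpose_mul matrix_mul_assoc)
  finally have "h \<in> carrier Sp4"
    using gh by (simp add: Sp4_def)
  then show ?thesis using that hg gh by blast
qed

lemma Sp4_inj:
  assumes "g \<in> carrier Sp4"
  shows "inj ((*v) g)"
  by (metis assms Sp4_inverse inj_on_inverseI matrix_vector_mul_assoc matrix_vector_mul_lid)

lemma image_matrix_mult: "(*v) g ` (*v) h ` l = (*v) (g ** h) ` l"
  for g :: "real^'n^'m" and h :: "real^'k^'n"
  by (simp add: image_image matrix_vector_mul_assoc)

lemma image_matrix_one: "(*v) (mat 1) ` l = l" for l :: "(real^'n) set"
  by simp

lemma lagrangian_image:
  assumes g: "g \<in> carrier Sp4" and l: "lagrangian l"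
  shows "lagrangian ((*v) g ` l)"
  unfolding lagrangian_def
proof (intro conjI)
  show "subspace ((*v) g ` l)"
    using l by (simp add: lagrangian_def linear_subspace_image)
  show "dim ((*v) g ` l) = 2"
    using l Sp4_inj[OF g] by (simp add: lagrangian_def dim_image_eq inj_on_subset)
  show "\<forall>u\<in>(*v) g ` l. \<forall>v\<in>(*v) g ` l. u \<bullet> (J4 *v v) = 0"
    using l Sp4_form[OF g] by (auto simp: lagrangian_def)
qed

lemma transverse_image:
  assumes "g \<in> carrier Sp4" "transverse l l'"
  shows "transverse ((*v) g ` l) ((*v) g ` l')"
  using assms Sp4_inj[OF assms(1)] by (simp add: transverse_def flip: image_Int)

lemma maximal_triple_image:
  assumes g: "g \<in> carrier Sp4" and m: "maximal_triple l1 l2 l3"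
  shows "maximal_triple ((*v) g ` l1) ((*v) g ` l2) ((*v) g ` l3)"
proof -
  obtain h where "h \<in> carrier Sp4" "l1 = (*v) h ` lag_infty" "l2 = (*v) h ` lag_of 0"
    "l3 = (*v) h ` lag_of (mat 1)"
    using m unfolding maximal_triple_def by blast
  then have "\<exists>h\<in>carrier Sp4. (*v) g ` l1 = (*v) h ` lag_infty \<and> (*v) g ` l2 = (*v) h ` lag_of 0 \<and>
      (*v) g ` l3 = (*v) h ` lag_of (mat 1)"
    using g Sp4_mult by (intro bexI[of _ "g ** h"]) (simp_all add: image_matrix_mult)
  then show ?thesis
    using g m by (simp add: maximal_triple_def lagrangian_image transverse_image)
qed

lemma maximal_tuple_image:
  assumes "g \<in> carrier Sp4" "maximal_tuple ls"
  shows "maximal_tuple (map ((`) ((*v) g)) ls)"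
  using assms by (auto simp: maximal_tuple_def intro: maximal_triple_image)

subsection \<open>Equivariance of the cross-ratio\<close>

lemma transverse_commute: "transverse l l' \<longleftrightarrow> transverse l' l"
  by (auto simp: transverse_def)

text \<open>Two planes of R^4 meeting only in 0 span everything, by counting dimensions. This
  justifies the definite description in \<open>proj_par\<close>.\<close>

lemma lagrangian_decomposition:
  assumes l: "lagrangian l" and l': "lagrangian l'" and t: "transverse l l'"
  shows "\<exists>!w. w \<in> l \<and> v - w \<in> l'"
proof -
  have s: "subspace l" "subspace l'" and d: "dim l = 2" "dim l' = 2"
    using l l' by (auto simp: lagrangian_def)
  have "dim {x + y |x y. x \<in> l \<and> y \<in> l'} = 4"
    using dim_sums_Int[OF s] t d by (simp add: transverse_def)
  then have "{x + y |x y. x \<in> l \<and> y \<in> l'} = UNIV"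
    using subspace_sums[OF s] dim_eq_full[of "{x + y |x y. x \<in> l \<and> y \<in> l'}"]
      span_eq_iff[of "{x + y |x y. x \<in> l \<and> y \<in> l'}"] by simp
  then obtain x y where xy: "x \<in> l" "y \<in> l'" "v = x + y"
    by blast
  show ?thesis
  proof (rule ex1I[of _ x])
    show "x \<in> l \<and> v - x \<in> l'" using xy by simp
  next
    fix w assume w: "w \<in> l \<and> v - w \<in> l'"
    then have "w - x \<in> l" "w - x \<in> l'"
      using xy s subspace_diff[of l w x] subspace_diff[of l' y "v - w"] by (auto simp: algebra_simps)
    then have "w - x \<in> l \<inter> l'" by blast
    then have "w - x = 0" using t unfolding transverse_def by blast
    then show "w = x" by simp
  qed
qed

lemma proj_par_eq:
  assumes "lagrangian l" "lagrangian l'" "transverse l l'" "w \<in> l" "v - w \<in> l'"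
  shows "proj_par l l' v = w"
  unfolding proj_par_def using lagrangian_decomposition[OF assms(1-3), of v] assms(4,5)
  by (intro the1_equality) auto

lemma proj_par_mem:
  assumes "lagrangian l" "lagrangian l'" "transverse l l'"
  shows "proj_par l l' v \<in> l" "v - proj_par l l' v \<in> l'"
  using theI'[OF lagrangian_decomposition[OF assms, of v]] by (auto simp: proj_par_def)

lemma proj_par_image:
  assumes g: "g \<in> carrier Sp4" and l: "lagrangian l" "lagrangian l'" "transverse l l'"
  shows "proj_par ((*v) g ` l) ((*v) g ` l') (g *v v) = g *v proj_par l l' v"
proof (rule proj_par_eq)
  show "g *v v - g *v proj_par l l' v \<in> (*v) g ` l'"
    using proj_par_mem[OF l] by (metis image_eqI matrix_vector_mult_diff_distrib)
qed (use assms proj_par_mem[OF l] in \<open>auto intro: lagrangian_image transverse_image\<close>)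

lemma maximal_quadruple_lagrangians:
  assumes "maximal_tuple [P, X, Y, Q]"
  shows "lagrangian P" "lagrangian X" "lagrangian Y" "lagrangian Q"
    "transverse P X" "transverse Q Y"
proof -
  have "maximal_triple P X Y" "maximal_triple X Y Q"
    using assms[unfolded maximal_tuple_def, rule_format, of 0 1 2]
      assms[unfolded maximal_tuple_def, rule_format, of 1 2 3] by simp_all
  then show "lagrangian P" "lagrangian X" "lagrangian Y" "lagrangian Q"
    "transverse P X" "transverse Q Y"
    by (auto simp: maximal_triple_def transverse_commute)
qed

lemma cross_ratio_image:
  assumes g: "g \<in> carrier Sp4" and m: "maximal_tuple [P, X, Y, Q]" and v: "v \<in> P"
  shows "cross_ratio ((*v) g ` P) ((*v) g ` X) ((*v) g ` Y) ((*v) g ` Q) (g *v v) =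
    g *v cross_ratio P X Y Q v"
  using v maximal_quadruple_lagrangians[OF m] by (simp add: cross_ratio_def proj_par_image[OF g])

text \<open>Transporting the basis \<open>B\<close> to \<open>g ** B\<close> leaves the matrix
  \<open>M\<close> of the cross-ratio unchanged.\<close>

lemma eigenvalue_pair_image:
  assumes g: "g \<in> carrier Sp4" and m: "maximal_tuple [P, X, Y, Q]"
    and e: "eigenvalue_pair P (cross_ratio P X Y Q) \<mu> \<nu>"
  shows "eigenvalue_pair ((*v) g ` P)
    (cross_ratio ((*v) g ` P) ((*v) g ` X) ((*v) g ` Y) ((*v) g ` Q)) \<mu> \<nu>"
proof -
  obtain B :: "real^2^4" and M where B: "inj ((*v) B)" "range ((*v) B) = P"
    and f: "\<And>x. cross_ratio P X Y Q (B *v x) = B *v (M *v x)"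
    and M: "\<forall>t. det (mat t - M) = (t - \<mu>) * (t - \<nu>)"
    using e unfolding eigenvalue_pair_def by blast
  have "(*v) (g ** B) = (*v) g \<circ> (*v) B"
    by (auto simp: matrix_vector_mul_assoc)
  then have "inj ((*v) (g ** B))" "range ((*v) (g ** B)) = (*v) g ` P"
    using B Sp4_inj[OF g] by (auto simp: inj_compose image_comp)
  moreover have "cross_ratio ((*v) g ` P) ((*v) g ` X) ((*v) g ` Y) ((*v) g ` Q) ((g ** B) *v x) =
      (g ** B) *v (M *v x)" for x
    using cross_ratio_image[OF g m, of "B *v x"] f B by (auto simp flip: matrix_vector_mul_assoc)
  ultimately show ?thesis
    using M unfolding eigenvalue_pair_def by blast
qed

lemma eigenvalue_pair_image_iff:
  assumes g: "g \<in> carrier Sp4" and m: "maximal_tuple [P, X, Y, Q]"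
  shows "eigenvalue_pair ((*v) g ` P)
    (cross_ratio ((*v) g ` P) ((*v) g ` X) ((*v) g ` Y) ((*v) g ` Q)) \<mu> \<nu> \<longleftrightarrow>
    eigenvalue_pair P (cross_ratio P X Y Q) \<mu> \<nu>"
proof
  assume e: "eigenvalue_pair ((*v) g ` P)
    (cross_ratio ((*v) g ` P) ((*v) g ` X) ((*v) g ` Y) ((*v) g ` Q)) \<mu> \<nu>"
  obtain h where h: "h \<in> carrier Sp4" "h ** g = mat 1"
    using Sp4_inverse[OF g] by blast
  have "maximal_tuple [(*v) g ` P, (*v) g ` X, (*v) g ` Y, (*v) g ` Q]"
    using maximal_tuple_image[OF g m] by simp
  from eigenvalue_pair_image[OF h(1) this e] show "eigenvalue_pair P (cross_ratio P X Y Q) \<mu> \<nu>"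
    by (simp add: image_matrix_mult h(2))
qed (rule eigenvalue_pair_image[OF assms])

lemma nongeneric_image:
  assumes "g \<in> carrier Sp4" "nongeneric P X Y Q"
  shows "nongeneric ((*v) g ` P) ((*v) g ` X) ((*v) g ` Y) ((*v) g ` Q)"
  using assms maximal_tuple_image[OF assms(1), of "[P, X, Y, Q]"] eigenvalue_pair_image
  unfolding nongeneric_def by fastforce

lemma length_vec_image:
  assumes "g \<in> carrier Sp4" "maximal_tuple [P, X, Y, Q]"
  shows "length_vec ((*v) g ` P) ((*v) g ` X) ((*v) g ` Y) ((*v) g ` Q) = length_vec P X Y Q"
  unfolding length_vec_def eigenvalue_pair_image_iff[OF assms] ..

subsection \<open>Scalar Lagrangians\<close>

text \<open>With R^4 seen as the tensor product of R^2 with itself, this is the pure tensor of (a,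
  b) and z. In the same picture \<open>block p q r s\<close> below is the Kronecker product of a 2x2
  matrix with the identity.\<close>

definition dvec :: "real \<Rightarrow> real \<Rightarrow> real^2 \<Rightarrow> real^4" where
  "dvec a b z = vector [a * z $ 1, a * z $ 2, b * z $ 1, b * z $ 2]"

text \<open>The Lagrangians \<open>dline a b\<close> with \<open>(a, b) \<noteq> 0\<close> form a projective line on which the
  matrices \<open>block p q r s\<close> with \<open>p * s - q * r = 1\<close> act by Moebius transformations;
  \<open>dline a 1\<close> is \<open>lag_of (mat a)\<close>.\<close>

definition dline :: "real \<Rightarrow> real \<Rightarrow> plane" where
  "dline a b = range (dvec a b)"

definition block :: "real \<Rightarrow> real \<Rightarrow> real \<Rightarrow> real \<Rightarrow> real^4^4" where
  "block p q r s = vector [vector [p, 0, q, 0], vector [0, p, 0, q],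
                           vector [r, 0, s, 0], vector [0, r, 0, s]]"

lemma dvec_nth [simp]:
  "dvec a b z $ 1 = a * z $ 1" "dvec a b z $ 2 = a * z $ 2"
  "dvec a b z $ 3 = b * z $ 1" "dvec a b z $ 4 = b * z $ 2"
  by (simp_all add: dvec_def)

lemma linear_dvec: "linear (dvec a b)"
  by (rule linearI) (simp_all add: vec_eq_iff forall_4 algebra_simps)

lemma inj_dvec:
  assumes "a \<noteq> 0 \<or> b \<noteq> 0"
  shows "inj (dvec a b)"
  using assms by (auto intro!: injI simp: vec_eq_iff forall_4 forall_2)

lemma dvec_scale: "dvec (k * a) (k * b) z = dvec a b (k *\<^sub>R z)"
  by (simp add: vec_eq_iff forall_4)

lemma dline_scale:
  assumes "k \<noteq> 0"
  shows "dline (k * a) (k * b) = dline a b"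
proof -
  have "range ((*\<^sub>R) k :: real^2 \<Rightarrow> real^2) = UNIV"
    using assms by (intro surjI[of _ "(*\<^sub>R) (1 / k)"]) simp
  moreover have "dvec (k * a) (k * b) = dvec a b \<circ> (*\<^sub>R) k"
    by (simp add: fun_eq_iff dvec_scale)
  ultimately show ?thesis
    unfolding dline_def by (metis image_comp)
qed

lemma block_dvec: "block p q r s *v dvec a b z = dvec (p * a + q * b) (r * a + s * b) z"
  by (simp add: block_def matrix_vector_mult_def vec_eq_iff forall_4 sum_4 algebra_simps)

lemma block_dline: "(*v) (block p q r s) ` dline a b = dline (p * a + q * b) (r * a + s * b)"
  by (simp add: dline_def image_image block_dvec)

text \<open>\<open>J4\<close> is the tensor product of the area form with the Euclidean one, so a
  block matrix multiplies it by the determinant of its 2x2 factor.\<close>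

lemma block_Sp4:
  assumes "p * s - q * r = 1"
  shows "block p q r s \<in> carrier Sp4"
proof -
  have "transpose (block p q r s) ** J4 ** block p q r s = (p * s - q * r) *\<^sub>R J4"
    by (simp add: block_def J4_def matrix_matrix_mult_def transpose_def vec_eq_iff forall_4 sum_4)
  then show ?thesis using assms by (simp add: Sp4_def)
qed

lemma dvec_form: "dvec a b z \<bullet> (J4 *v dvec c d w) = (a * d - b * c) * (z \<bullet> w)"
  unfolding J4_form by (simp add: inner_vec_def sum_2 algebra_simps)

lemma lag_infty_eq: "lag_infty = dline 1 0"
proof -
  have "z \<in> span {axis 1 1, axis 2 1}" for z :: "real^2"
  proof -
    have "z = z $ 1 *\<^sub>R axis 1 1 + z $ 2 *\<^sub>R axis 2 1"
      by (simp add: vec_eq_iff forall_2 axis_def)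
    also have "\<dots> \<in> span {axis 1 1, axis 2 1}"
      by (intro span_add span_scale span_base) auto
    finally show ?thesis .
  qed
  then have "span {axis 1 1, axis 2 1 :: real^2} = UNIV" by blast
  moreover have "dvec 1 0 (axis 1 1) = axis 1 1" "dvec 1 0 (axis 2 1) = axis 2 1"
    by (simp_all add: vec_eq_iff forall_4, simp_all add: axis_def)
  ultimately show ?thesis
    using linear_span_image[OF linear_dvec, of 1 0 "{axis 1 1, axis 2 1}"]
    by (simp add: lag_infty_def dline_def)
qed

lemma span_columns: "span (columns A) = range ((*v) A)" for A :: "real^'n^'m"
proof -
  have "range (\<lambda>i. axis i 1) = (Basis :: (real^'n) set)"
    by (auto simp: Basis_vec_def)
  then show ?thesis
    by (simp add: columns_image_basis linear_span_image)
qed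

lemma lag_of_mat: "lag_of (mat a) = dline a 1"
proof -
  have "(vector [mat a $ 1, mat a $ 2, mat 1 $ 1, mat 1 $ 2] :: real^2^4) *v z = dvec a 1 z" for z
    by (simp add: vec_eq_iff forall_4 matrix_vector_mult_def sum_2 mat_def)
  then show ?thesis
    by (simp add: lag_of_def span_columns dline_def)
qed

lemma lag_of_zero: "lag_of 0 = dline 0 1"
  using lag_of_mat[of 0] by (simp add: mat_def flip: zero_vec_def)

lemma lagrangian_dline:
  assumes "a \<noteq> 0 \<or> b \<noteq> 0"
  shows "lagrangian (dline a b)"
proof -
  have "dim (dline a b) = dim (UNIV :: (real^2) set)"
    unfolding dline_def using linear_dvec inj_dvec[OF assms] by (intro dim_image_eq) auto
  then show ?thesis
    using linear_dvec by (auto simp: lagrangian_def dline_def dvec_form linear_subspace_image)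
qed

lemma transverse_dline:
  assumes "a * d - b * c \<noteq> 0"
  shows "transverse (dline a b) (dline c d)"
proof -
  have "dvec a b z = 0" if e: "dvec a b z = dvec c d w" for z w
  proof -
    have c: "a * z $ 1 = c * w $ 1" "a * z $ 2 = c * w $ 2"
        "b * z $ 1 = d * w $ 1" "b * z $ 2 = d * w $ 2"
      using e by (simp_all add: vec_eq_iff forall_4)
    \<comment> \<open>Take d times the first relation minus c times the third, which eliminates
      w.\<close>
    have "(a * d - b * c) * z $ 1 = 0" using c(1,3) by algebra
    moreover have "(a * d - b * c) * z $ 2 = 0" using c(2,4) by algebra
    ultimately
    show ?thesis using assms by (simp add: vec_eq_iff forall_4)
  qed
  moreover have "0 \<in> dline x y" for x y
    unfolding dline_def using linear_0[OF linear_dvec] by (metis rangeI)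
  ultimately show ?thesis
    by (auto simp: transverse_def dline_def)
qed

section \<open>Maximality of triples of scalar Lagrangians\<close>

lemma maximal_triple_standard: "maximal_triple (dline 1 0) (dline 0 1) (dline 1 1)"
  unfolding maximal_triple_def lag_infty_eq lag_of_zero lag_of_mat
  using Sp4_one
  by (auto intro!: lagrangian_dline transverse_dline bexI[of _ "mat 1"] simp: image_matrix_one)

text \<open>The hypothesis is the product of the three determinants of cyclically consecutive
  vectors. Each vector enters two factors, so the sign depends only on the points of the projective
  line and records their cyclic orientation; SL(2,R) is transitive on triples of one
  orientation.\<close>

lemma maximal_triple_dline:
  assumes "(a * d - b * c) * (c * f - d * e) * (e * b - f * a) > 0"
  shows "maximal_triple (dline a b) (dline c d) (dline e f)"
proof -
  define D where "D = (a * d - b * c) * (c * f - d * e) * (e * b - f * a)"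
  \<comment> \<open>The matrix \<open>?g\<close> below comes from a 2x2 matrix of determinant
    \<open>k * k * D\<close>, so this choice makes it symplectic.\<close>
  define k where "k = 1 / sqrt D"
  have D: "D > 0" using assms by (simp add: D_def)
  then have k: "k \<noteq> 0" "k * k * D = 1" by (simp_all add: k_def)
  have nz: "a * d - b * c \<noteq> 0" "c * f - d * e \<noteq> 0" "e * b - f * a \<noteq> 0"
    using D by (auto simp: D_def)
  \<comment> \<open>By Cramer's rule \<open>s * (a, b) + t * (c, d)\<close> is a multiple of \<open>(e, f)\<close>.\<close>
  define s t where "s = - k * (c * f - d * e)" and "t = - k * (e * b - f * a)"
  let ?g = "block (s * a) (t * c) (s * b) (t * d)"
  have "s * a * (t * d) - t * c * (s * b) = k * k * D"
    by (simp add: s_def t_def D_def algebra_simps)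
  then have g: "?g \<in> carrier Sp4" using k by (simp add: block_Sp4)
  have "s * a + t * c = (k * (a * d - b * c)) * e" "s * b + t * d = (k * (a * d - b * c)) * f"
    by (simp_all add: s_def t_def algebra_simps)
  then have "(*v) ?g ` dline 1 1 = dline e f"
    using dline_scale[of "k * (a * d - b * c)" e f] nz k by (simp add: block_dline)
  moreover have "(*v) ?g ` dline 1 0 = dline a b" "(*v) ?g ` dline 0 1 = dline c d"
    using dline_scale[of s a b] dline_scale[of t c d] nz k
    by (simp_all add: block_dline s_def t_def)
  ultimately show ?thesis
    using maximal_triple_image[OF g maximal_triple_standard] by simp
qed

text \<open>This is positivity of the Maslov form of the triple, an obstruction to maximality. On
  the standard triple u = (x, 0) and v = (0, y) force x = y, and the value is the squared norm of x;
  symplectic invariance gives the rest.\<close>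

lemma maximal_triple_form_pos:
  assumes m: "maximal_triple l1 l2 l3" and uv: "u \<in> l1" "v \<in> l2" "u + v \<in> l3" "u \<noteq> 0"
  shows "u \<bullet> (J4 *v v) > 0"
proof -
  obtain g where g: "g \<in> carrier Sp4" and l: "l1 = (*v) g ` dline 1 0" "l2 = (*v) g ` dline 0 1"
    "l3 = (*v) g ` dline 1 1"
    using m unfolding maximal_triple_def lag_infty_eq lag_of_zero lag_of_mat by blast
  obtain x y z where xyz: "u = g *v dvec 1 0 x" "v = g *v dvec 0 1 y" "u + v = g *v dvec 1 1 z"
    using uv(1-3) unfolding l dline_def by blast
  then have "dvec 1 0 x + dvec 0 1 y = dvec 1 1 z"
    by (metis Sp4_inj[OF g] injD matrix_vector_right_distrib)
  then have "x = y" by (simp add: vec_eq_iff forall_4 forall_2)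
  moreover have "x \<noteq> 0"
    using uv(4) xyz(1) linear_0[OF linear_dvec] by auto
  ultimately show ?thesis
    using xyz by (simp add: Sp4_form[OF g] dvec_form)
qed

lemma maximal_triple_dline_less:
  assumes "maximal_triple (dline a 1) (dline b 1) (dline 1 0)"
  shows "a < b"
proof -
  let ?z = "axis 1 1 :: real^2"
  \<comment> \<open>The lower halves cancel, so the sum lies in \<open>dline 1 0\<close>, and the
    form takes the value b - a on the two summands.\<close>
  have "dvec a 1 ?z + dvec b 1 (- ?z) = dvec 1 0 ((a - b) *\<^sub>R ?z)"
    by (simp add: vec_eq_iff forall_4 algebra_simps)
  moreover have "dvec a 1 ?z \<noteq> 0"
    by (simp add: vec_eq_iff forall_4)
  ultimately have "dvec a 1 ?z \<bullet> (J4 *v dvec b 1 (- ?z)) > 0"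
    using maximal_triple_form_pos[OF assms] by (simp add: dline_def)
  then show ?thesis
    by (simp add: dvec_form)
qed

subsection \<open>The cross-ratio in the affine chart\<close>

text \<open>The existential over bases in \<open>eigenvalue_pair\<close> may be tested on one chosen
  basis, because matrices of the same endomorphism are conjugate.\<close>

lemma eigenvalue_pair_basis:
  fixes E :: "real^2^4" and Y :: "real^2^2"
  assumes E: "inj ((*v) E)" "range ((*v) E) = l" and f: "\<And>x. f (E *v x) = E *v (Y *v x)"
  shows "eigenvalue_pair l f \<mu> \<nu> \<longleftrightarrow> (\<forall>t. det (mat t - Y) = (t - \<mu>) * (t - \<nu>))"
proof
  assume "eigenvalue_pair l f \<mu> \<nu>"
  then obtain B :: "real^2^4" and M where B: "inj ((*v) B)" "range ((*v) B) = l"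
    and fB: "\<And>x. f (B *v x) = B *v (M *v x)"
    and M: "\<forall>t. det (mat t - M) = (t - \<mu>) * (t - \<nu>)"
    unfolding eigenvalue_pair_def by blast
  obtain e where e: "linear e" "e \<circ> (*v) E = id"
    using linear_injective_left_inverse[OF matrix_vector_mul_linear E(1)] by blast
  \<comment> \<open>\<open>N\<close> is the change of basis: its columns are the coordinates of
    those of \<open>B\<close> with respect to \<open>E\<close>.\<close>
  define N :: "real^2^2" where "N = matrix (e \<circ> (*v) B)"
  have N: "N *v x = e (B *v x)" for x
    using matrix_vector_mul(2)[OF linear_compose[OF matrix_vector_mul_linear e(1)], of B]
    by (metis N_def comp_apply)
  have EN: "E *v (N *v x) = B *v x" for x
  proof -
    obtain z where "B *v x = E *v z" using E(2) B(2) by (metis rangeE rangeI)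
    then show ?thesis using e(2) by (simp add: N pointfree_idE)
  qed
  have "inj ((*v) N)"
    using B(1) by (metis EN inj_def)
  then have "det N \<noteq> 0"
    using matrix_left_invertible_injective invertible_left_inverse invertible_det_nz
    by (metis inj_def)
  moreover have "N ** M = Y ** N"
  proof -
    have "E *v (N *v (M *v x)) = E *v (Y *v (N *v x))" for x
      by (metis EN f fB)
    then have "N *v (M *v x) = Y *v (N *v x)" for x
      using E(1) by (meson injD)
    then show ?thesis
      by (simp add: matrix_eq flip: matrix_vector_mul_assoc)
  qed
  \<comment> \<open>The intertwining relation passes to the characteristic matrices; taking
    determinants and cancelling \<open>det N\<close> identifies the two polynomials.\<close>
  then have "N ** (mat t - M) = (mat t - Y) ** N" for t
    by (simp add: matrix_matrix_mult_def mat_def vec_eq_iff forall_2 sum_2 algebra_simps)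
  then have "det N * det (mat t - M) = det (mat t - Y) * det N" for t
    by (metis det_mul)
  ultimately show "\<forall>t. det (mat t - Y) = (t - \<mu>) * (t - \<nu>)"
    using M by simp
qed (use assms in \<open>auto simp: eigenvalue_pair_def\<close>)

text \<open>The plane of all vectors (X y, y), that is, the span of the columns of X above the
  identity. Splitting off the two halves with \<open>dvec\<close> suits the projections along 0 and
  infinity.\<close>

definition graph :: "real^2^2 \<Rightarrow> plane" where
  "graph X = range (\<lambda>y. dvec 1 0 (X *v y) + dvec 0 1 y)"

lemma mat_mult_vec: "mat t *v z = t *\<^sub>R z" for z :: "real^2"
  by (simp add: vec_eq_iff forall_2 matrix_vector_mult_def sum_2 mat_def)

lemma graph_mat: "graph (mat b) = dline b 1"
proof -
  have "dvec 1 0 (mat b *v y) + dvec 0 1 y = dvec b 1 y" for y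
    by (simp add: vec_eq_iff forall_4 mat_mult_vec)
  then show ?thesis by (simp add: graph_def dline_def)
qed

text \<open>A complement of infinity projects bijectively to the lower half of R^4, hence is a
  graph; isotropy is exactly the symmetry of its matrix.\<close>

lemma lagrangian_eq_graph:
  assumes l: "lagrangian l" and t: "transverse l (dline 1 0)"
  obtains X where "transpose X = X" "l = graph X"
proof -
  have s: "subspace l" using l by (simp add: lagrangian_def)
  have ex: "\<exists>x. dvec 1 0 x + dvec 0 1 y \<in> l" for y
  proof -
    obtain w where "w \<in> l" "dvec 0 1 y - w \<in> dline 1 0"
      using lagrangian_decomposition[OF l lagrangian_dline t, of "dvec 0 1 y"] by auto
    then obtain x where "dvec 0 1 y - w = dvec 1 0 x" by (auto simp: dline_def)
    then have "w = dvec 1 0 (- x) + dvec 0 1 y"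
      using linear_neg[OF linear_dvec, of 1 0 x] by (simp add: algebra_simps)
    then show ?thesis using \<open>w \<in> l\<close> by blast
  qed
  obtain x1 x2 where x: "dvec 1 0 x1 + dvec 0 1 (axis 1 1) \<in> l" "dvec 1 0 x2 + dvec 0 1 (axis 2 1) \<in> l"
    using ex by meson
  \<comment> \<open>The columns of \<open>X\<close> are \<open>x1\<close> and \<open>x2\<close>, the
    upper halves lying over the two basis vectors.\<close>
  define X :: "real^2^2" where "X = vector [vector [x1 $ 1, x2 $ 1], vector [x1 $ 2, x2 $ 2]]"
  have mem: "dvec 1 0 (X *v y) + dvec 0 1 y \<in> l" for y
  proof -
    have "dvec 1 0 (X *v y) + dvec 0 1 y = y $ 1 *\<^sub>R (dvec 1 0 x1 + dvec 0 1 (axis 1 1)) +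
        y $ 2 *\<^sub>R (dvec 1 0 x2 + dvec 0 1 (axis 2 1))"
      by (simp add: vec_eq_iff forall_4 X_def matrix_vector_mult_def sum_2 axis_def algebra_simps)
    then show ?thesis using x s by (simp add: subspace_add subspace_scale)
  qed
  have "l \<subseteq> graph X"
  proof
    fix p assume p: "p \<in> l"
    define y :: "real^2" where "y = vector [p $ 3, p $ 4]"
    define x :: "real^2" where "x = vector [p $ 1, p $ 2]"
    \<comment> \<open>Two vectors of \<open>l\<close> with equal lower halves differ by an element
      of \<open>dline 1 0\<close>, so by transversality they coincide.\<close>
    have "p - (dvec 1 0 (X *v y) + dvec 0 1 y) = dvec 1 0 (x - X *v y)"
      by (simp add: vec_eq_iff forall_4 x_def y_def)
    then have "p - (dvec 1 0 (X *v y) + dvec 0 1 y) \<in> l \<inter> dline 1 0"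
      using subspace_diff[OF s p mem[of y]] by (simp add: dline_def)
    then have "p - (dvec 1 0 (X *v y) + dvec 0 1 y) = 0"
      using t unfolding transverse_def by blast
    then have "p = dvec 1 0 (X *v y) + dvec 0 1 y" by simp
    then show "p \<in> graph X" by (simp add: graph_def)
  qed
  then have "l = graph X" using mem by (auto simp: graph_def)
  \<comment> \<open>Evaluated in coordinates, this pairing is the difference of the two off-diagonal
    entries of \<open>X\<close>.\<close>
  moreover have "(dvec 1 0 x1 + dvec 0 1 (axis 1 1)) \<bullet> (J4 *v (dvec 1 0 x2 + dvec 0 1 (axis 2 1))) = 0"
    using l x by (auto simp: lagrangian_def)
  then have "transpose X = X"
    unfolding J4_form by (simp add: X_def transpose_def vec_eq_iff forall_2 axis_def)
  ultimately show ?thesis using that by blast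
qed

text \<open>The two projections send (0, y) first to (- X y, 0) and then to (0, X y / a). This is
  R(0, Z, X, infinity) = Z^(-1) X for Z = a Id.\<close>

lemma cross_ratio_graph:
  assumes a: "a \<noteq> 0" and l: "lagrangian (graph X)" and t: "transverse (graph X) (dline 1 0)"
  shows "cross_ratio (dline 0 1) (dline a 1) (graph X) (dline 1 0) (dvec 0 1 y) =
    dvec 0 1 (((1 / a) *\<^sub>R X) *v y)"
proof -
  have 1: "proj_par (dline 1 0) (graph X) (dvec 0 1 y) = dvec 1 0 (- (X *v y))"
  proof (rule proj_par_eq)
    have "dvec 0 1 y - dvec 1 0 (- (X *v y)) = dvec 1 0 (X *v y) + dvec 0 1 y"
      by (simp add: vec_eq_iff forall_4)
    then show "dvec 0 1 y - dvec 1 0 (- (X *v y)) \<in> graph X" unfolding graph_def by (rule range_eqI)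
  qed (use l t lagrangian_dline in \<open>auto simp: transverse_commute dline_def\<close>)
  have 2: "proj_par (dline 0 1) (dline a 1) (dvec 1 0 (- (X *v y))) =
      dvec 0 1 (((1 / a) *\<^sub>R X) *v y)"
  proof (rule proj_par_eq)
    have "dvec 1 0 (- (X *v y)) - dvec 0 1 (((1 / a) *\<^sub>R X) *v y) =
        dvec a 1 (- (((1 / a) *\<^sub>R X) *v y))"
      using a by (simp add: vec_eq_iff forall_4 flip: scaleR_matrix_vector_assoc)
    then show "dvec 1 0 (- (X *v y)) - dvec 0 1 (((1 / a) *\<^sub>R X) *v y) \<in> dline a 1"
      by (simp add: dline_def)
  qed (use a lagrangian_dline transverse_dline in \<open>auto simp: dline_def\<close>)
  show ?thesis
    using 1 2 by (simp add: cross_ratio_def dline_def)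
qed

lemma eigenvalue_pair_graph:
  assumes "a \<noteq> 0" "lagrangian (graph X)" "transverse (graph X) (dline 1 0)"
  shows "eigenvalue_pair (dline 0 1) (cross_ratio (dline 0 1) (dline a 1) (graph X) (dline 1 0)) \<mu> \<nu> \<longleftrightarrow>
    (\<forall>t. det (mat t - (1 / a) *\<^sub>R X) = (t - \<mu>) * (t - \<nu>))"
proof (rule eigenvalue_pair_basis)
  have E: "matrix (dvec 0 1) *v z = dvec 0 1 z" for z
    using matrix_vector_mul(2)[OF linear_dvec, of 0 1] by metis
  then show "inj ((*v) (matrix (dvec 0 1)))" "range ((*v) (matrix (dvec 0 1))) = dline 0 1"
    using inj_dvec[of 0 1] by (simp_all add: dline_def inj_def)
  show "cross_ratio (dline 0 1) (dline a 1) (graph X) (dline 1 0) (matrix (dvec 0 1) *v z) =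
      matrix (dvec 0 1) *v (((1 / a) *\<^sub>R X) *v z)" for z
    unfolding E by (rule cross_ratio_graph[OF assms])
qed

section \<open>Eigenvalues and lengths of quadruples of scalar Lagrangians\<close>

lemma det_char_mat: "det (mat t - mat c :: real^2^2) = (t - c) * (t - c)"
  by (simp add: det_2 mat_def)

lemma eigenvalue_pair_dline:
  assumes "a \<noteq> 0"
  shows "eigenvalue_pair (dline 0 1) (cross_ratio (dline 0 1) (dline a 1) (dline b 1) (dline 1 0)) \<mu> \<nu> \<longleftrightarrow>
    \<mu> = b / a \<and> \<nu> = b / a"
proof -
  have "(1 / a) *\<^sub>R mat b = (mat (b / a) :: real^2^2)"
    by (simp add: vec_eq_iff forall_2 mat_def)
  then have "eigenvalue_pair (dline 0 1) (cross_ratio (dline 0 1) (dline a 1) (dline b 1) (dline 1 0)) \<mu> \<nu> \<longleftrightarrow>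
      (\<forall>t. (t - b / a) * (t - b / a) = (t - \<mu>) * (t - \<nu>))"
    using eigenvalue_pair_graph[OF assms, of "mat b"]
    by (simp add: graph_mat lagrangian_dline transverse_dline det_char_mat)
  also have "\<dots> \<longleftrightarrow> \<mu> = b / a \<and> \<nu> = b / a"
  proof
    assume "\<forall>t. (t - b / a) * (t - b / a) = (t - \<mu>) * (t - \<nu>)"
    \<comment> \<open>At t = \<mu> and t = \<nu> the right side vanishes, so each of the two is a
      root of the square on the left.\<close>
    from this[rule_format, of \<mu>] this[rule_format, of \<nu>] show "\<mu> = b / a \<and> \<nu> = b / a" by simp
  qed simp
  finally show ?thesis .
qed

lemma length_vec_dline:
  assumes "a \<noteq> 0"
  shows "length_vec (dline 0 1) (dline a 1) (dline b 1) (dline 1 0) = (ln (b / a), ln (b / a))"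
  unfolding length_vec_def eigenvalue_pair_dline[OF assms] by auto

text \<open>The endomorphism of a non-generic quadruple is symmetric in this chart, hence
  diagonalizable, hence a homothety as its eigenvalues agree.\<close>

lemma symmetric_double_eigenvalue:
  fixes Y :: "real^2^2"
  assumes s: "transpose Y = Y" and d: "\<forall>t. det (mat t - Y) = (t - \<mu>) * (t - \<mu>)"
  shows "Y = mat \<mu>"
proof -
  have y: "Y $ 2 $ 1 = Y $ 1 $ 2"
    using arg_cong[OF s, of "\<lambda>Z. Z $ 1 $ 2"] by (simp add: transpose_def)
  have e: "(t - Y $ 1 $ 1) * (t - Y $ 2 $ 2) - Y $ 1 $ 2 * Y $ 1 $ 2 = (t - \<mu>) * (t - \<mu>)" for t
    using d[rule_format, of t] y by (simp add: det_2 mat_def)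
  \<comment> \<open>At a diagonal entry of \<open>Y\<close> the product on the left of
    \<open>e\<close> vanishes, leaving a sum of two squares equal to 0.\<close>
  have "(Y $ 1 $ 1 - \<mu>)\<^sup>2 + (Y $ 1 $ 2)\<^sup>2 = 0" "(Y $ 2 $ 2 - \<mu>)\<^sup>2 + (Y $ 1 $ 2)\<^sup>2 = 0"
    using e[of "Y $ 1 $ 1"] e[of "Y $ 2 $ 2"] by (simp_all add: power2_eq_square algebra_simps)
  then show ?thesis
    using y by (simp add: sum_power2_eq_zero_iff vec_eq_iff forall_2 mat_def)
qed

text \<open>The inductive step along the hexagon. Taking c as the ratio to the previous scalar makes
  it the double eigenvalue of the cross-ratio and lets the conclusion feed the next
  application.\<close>

lemma nongeneric_dline:
  assumes n: "nongeneric (dline 0 1) (dline a 1) B (dline 1 0)" and a: "a > 0"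
  obtains c where "c > 1" "B = dline (a * c) 1"
proof -
  have "maximal_tuple [dline 0 1, dline a 1, B, dline 1 0]"
    using n by (simp add: nongeneric_def)
  \<comment> \<open>This subtriple omits the Lagrangian 0. It yields both the chart for
    \<open>B\<close> and, once \<open>B\<close> is scalar, the bound c > 1.\<close>
  from this[unfolded maximal_tuple_def, rule_format, of 1 2 3]
  have m: "maximal_triple (dline a 1) B (dline 1 0)"
    by simp
  then have l: "lagrangian B" "transverse B (dline 1 0)"
    by (auto simp: maximal_triple_def)
  obtain X where X: "transpose X = X" "B = graph X"
    using lagrangian_eq_graph[OF l] .
  obtain \<mu> where "\<forall>t. det (mat t - (1 / a) *\<^sub>R X) = (t - \<mu>) * (t - \<mu>)"
    using n a l eigenvalue_pair_graph[of a X] unfolding nongeneric_def X(2) by auto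
  moreover have "transpose ((1 / a) *\<^sub>R X) = (1 / a) *\<^sub>R X"
    using X(1) by (simp add: transpose_scalar)
  ultimately have "(1 / a) *\<^sub>R X = mat \<mu>"
    by (intro symmetric_double_eigenvalue)
  then have "a *\<^sub>R ((1 / a) *\<^sub>R X) = a *\<^sub>R mat \<mu>"
    by simp
  then have "X = a *\<^sub>R mat \<mu>"
    using a by simp
  also have "\<dots> = mat (a * \<mu>)"
    by (simp add: vec_eq_iff forall_2 mat_def)
  finally have B: "B = dline (a * \<mu>) 1"
    using X by (simp add: graph_mat)
  have "a < a * \<mu>"
    using m maximal_triple_dline_less unfolding B by blast
  then have "\<mu> > 1" using a by simp
  then show ?thesis using that B by blast
qed

subsection \<open>Hexagons\<close>

definition hex_image :: "real^4^4 \<Rightarrow> hexagon \<Rightarrow> hexagon" where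
  "hex_image g = (\<lambda>(P, A, B, C, D, Q).
     ((*v) g ` P, (*v) g ` A, (*v) g ` B, (*v) g ` C, (*v) g ` D, (*v) g ` Q))"

definition standard_hex :: "real \<Rightarrow> real \<Rightarrow> real \<Rightarrow> hexagon" where
  "standard_hex b c d =
     (dline 0 1, dline 1 1, dline b 1, dline (b * c) 1, dline (b * c * d) 1, dline 1 0)"

lemma hex_image_mult: "hex_image g (hex_image h x) = hex_image (g ** h) x"
  by (simp add: hex_image_def image_matrix_mult split: prod.splits)

lemma hex_image_one: "hex_image (mat 1) x = x"
  by (simp add: hex_image_def split: prod.splits)

lemma hex_image_H:
  assumes "g \<in> carrier Sp4" "x \<in> H_nongen_type3"
  shows "hex_image g x \<in> H_nongen_type3"
proof -
  obtain P A B C D Q where x: "x = (P, A, B, C, D, Q)" by (cases x)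
  show ?thesis
    using assms maximal_tuple_image[OF assms(1), of "[P, A, B, C, D, Q]"]
    by (auto simp: x H_nongen_type3_def hex_image_def intro: nongeneric_image)
qed

lemma length_params_hex_image:
  assumes "g \<in> carrier Sp4" "x \<in> H_nongen_type3"
  shows "length_params (hex_image g x) = length_params x"
  using assms
  by (auto simp: H_nongen_type3_def hex_image_def length_params_def nongeneric_def length_vec_image)

lemma standard_hex_length_params:
  assumes "b > 0" "c > 0" "d > 0"
  shows "length_params (standard_hex b c d) = ((ln b, ln b), (ln c, ln c), (ln d, ln d))"
  using assms by (simp add: standard_hex_def length_params_def length_vec_dline)

lemma maximal_tuple_dlines:
  assumes "sorted_wrt (<) xs"
  shows "maximal_tuple (map (\<lambda>a. dline a 1) xs @ [dline 1 0])"
  unfolding maximal_tuple_def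
proof (intro allI impI)
  fix i j k :: nat
  assume ijk: "i < j \<and> j < k \<and> k < length (map (\<lambda>a. dline a 1) xs @ [dline 1 0])"
  then have ij: "xs ! i < xs ! j"
    using assms by (simp add: sorted_wrt_iff_nth_less)
  show "maximal_triple ((map (\<lambda>a. dline a 1) xs @ [dline 1 0]) ! i)
    ((map (\<lambda>a. dline a 1) xs @ [dline 1 0]) ! j) ((map (\<lambda>a. dline a 1) xs @ [dline 1 0]) ! k)"
  proof (cases "k < length xs")
    case True
    then have "xs ! j < xs ! k"
      using assms ijk by (simp add: sorted_wrt_iff_nth_less)
    \<comment> \<open>For three finite points the orientation product has two negative factors and
      one positive factor.\<close>
    then have "(xs ! i - xs ! j) * (xs ! j - xs ! k) * (xs ! k - xs ! i) > 0"
      using ij by (intro mult_pos_pos mult_neg_neg) auto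
    then show ?thesis
      using True ijk by (simp add: nth_append maximal_triple_dline)
  next
    \<comment> \<open>Here k is the last index, belonging to infinity = (1, 0), and the orientation
      product reduces to \<open>xs ! j - xs ! i\<close>.\<close>
    case False
    then show ?thesis
      using ijk ij by (simp add: nth_append maximal_triple_dline)
  qed
qed

lemma standard_hex_H:
  assumes "b > 1" "c > 1" "d > 1"
  shows "standard_hex b c d \<in> H_nongen_type3"
proof -
  have bcd: "b < b * c" "b * c < b * c * d" "0 < b * c" "0 < b"
    using assms by simp_all
  then have "nongeneric (dline 0 1) (dline 1 1) (dline b 1) (dline 1 0)"
    "nongeneric (dline 0 1) (dline b 1) (dline (b * c) 1) (dline 1 0)"
    "nongeneric (dline 0 1) (dline (b * c) 1) (dline (b * c * d) 1) (dline 1 0)"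
    using assms maximal_tuple_dlines[of "[0, 1, b]"] maximal_tuple_dlines[of "[0, b, b * c]"]
      maximal_tuple_dlines[of "[0, b * c, b * c * d]"]
    by (auto simp: nongeneric_def eigenvalue_pair_dline)
  moreover have "sorted_wrt (<) [0, 1, b, u, v]" if "b < u" "u < v" for u v
    using assms(1) that by simp
  then have "sorted_wrt (<) [0, 1, b, b * c, b * c * d]"
    using bcd by blast
  ultimately show ?thesis
    using maximal_tuple_dlines[of "[0, 1, b, b * c, b * c * d]"]
    by (simp add: H_nongen_type3_def standard_hex_def)
qed

lemma normal_form:
  assumes "x \<in> H_nongen_type3"
  obtains g b c d where "g \<in> carrier Sp4" "b > 1" "c > 1" "d > 1" "hex_image g x = standard_hex b c d"
proof -
  obtain P A B C D Q where x: "x = (P, A, B, C, D, Q)" by (cases x)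
  have m: "maximal_tuple [P, A, B, C, D, Q]"
    and n: "nongeneric P A B Q" "nongeneric P B C Q" "nongeneric P C D Q"
    using assms by (auto simp: x H_nongen_type3_def)
  have "maximal_triple P A Q"
    using m[unfolded maximal_tuple_def, rule_format, of 0 1 5] by simp
  then obtain h where h: "h \<in> carrier Sp4" "P = (*v) h ` dline 1 0" "A = (*v) h ` dline 0 1"
    "Q = (*v) h ` dline 1 1"
    unfolding maximal_triple_def lag_infty_eq lag_of_zero lag_of_mat by blast
  obtain h' where h': "h' \<in> carrier Sp4" "h' ** h = mat 1"
    using Sp4_inverse[OF h(1)] by blast
  \<comment> \<open>The block matrix rotates the triple with parameters \<open>(\<infinity>, 0, 1)\<close> to \<open>(0, 1, \<infinity>)\<close>.\<close>
  define g where "g = block 0 1 (-1) 1 ** h'"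
  have g: "g \<in> carrier Sp4"
    unfolding g_def using h'(1) by (intro Sp4_mult block_Sp4) simp_all
  have gh: "(*v) g ` (*v) h ` l = (*v) (block 0 1 (-1) 1) ` l" for l
    by (simp add: g_def image_matrix_mult h'(2) flip: matrix_mul_assoc)
  \<comment> \<open>The block sends (1, 0) to (0, -1), and the scaling by -1 identifies the
    resulting line with \<open>dline 0 1\<close>.\<close>
  have PAQ: "(*v) g ` P = dline 0 1" "(*v) g ` A = dline 1 1" "(*v) g ` Q = dline 1 0"
    using dline_scale[of "-1" 0 1] by (simp_all add: h(2-4) gh block_dline)
  note n' = nongeneric_image[OF g n(1), unfolded PAQ] nongeneric_image[OF g n(2), unfolded PAQ]
    nongeneric_image[OF g n(3), unfolded PAQ]
  \<comment> \<open>The three quadruples share P and Q, so one normalization serves all of them; the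
    scalar of the second vertex is 1, then b, then b c.\<close>
  obtain b where b: "b > 1" "(*v) g ` B = dline b 1"
    using nongeneric_dline[OF n'(1)] by auto
  obtain c where c: "c > 1" "(*v) g ` C = dline (b * c) 1"
    using nongeneric_dline[OF n'(2)[unfolded b(2)]] b(1) by auto
  obtain d where d: "d > 1" "(*v) g ` D = dline (b * c * d) 1"
    using nongeneric_dline[OF n'(3)[unfolded c(2)]] b(1) c(1) by auto
  have "hex_image g x = standard_hex b c d"
    by (simp add: x hex_image_def standard_hex_def PAQ b c d)
  then show ?thesis using that g b c d by blast
qed

subsection \<open>Orbits of the projective group\<close>

lemma carrier_PSp4: "carrier PSp4 = (\<lambda>g. {g, - g}) ` carrier Sp4"
proof -
  have "{mat 1, - mat 1} #>\<^bsub>Sp4\<^esub> g = {g, - g}" for g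
  proof -
    have "(- mat 1) ** g = - g"
      by (simp add: matrix_matrix_mult_def mat_def vec_eq_iff forall_4 sum_4)
    then show ?thesis by (auto simp: r_coset_def Sp4_def)
  qed
  then show ?thesis
    by (auto simp: PSp4_def FactGroup_def RCOSETS_def)
qed

lemma PSp4_act_pair:
  assumes "subspace l"
  shows "PSp4_act {g, - g} l = (*v) g ` l"
proof -
  have "(- g) *v v = g *v (- v)" for v
    by (simp add: matrix_vector_mult_def vec_eq_iff sum_negf)
  then have "(*v) (- g) ` l = (*v) g ` uminus ` l"
    by (simp add: image_image)
  also have "uminus ` l = l"
    using subspace_neg[OF assms] by (force simp: image_iff)
  finally show ?thesis by (simp add: PSp4_act_def)
qed

lemma PSp4_act_hex_pair:
  assumes "x \<in> H_nongen_type3"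
  shows "PSp4_act_hex {g, - g} x = hex_image g x"
proof -
  obtain P A B C D Q where x: "x = (P, A, B, C, D, Q)" by (cases x)
  have "maximal_tuple [P, A, B, Q]" "maximal_tuple [P, C, D, Q]"
    using assms by (auto simp: x H_nongen_type3_def nongeneric_def)
  then show ?thesis
    using maximal_quadruple_lagrangians
    by (auto simp: x PSp4_act_hex_def hex_image_def lagrangian_def intro!: PSp4_act_pair)
qed

lemma orbit_PSp4:
  assumes "x \<in> H_nongen_type3"
  shows "orbit PSp4 PSp4_act_hex x = (\<lambda>g. hex_image g x) ` carrier Sp4"
proof -
  have "orbit PSp4 PSp4_act_hex x = (\<lambda>K. PSp4_act_hex K x) ` carrier PSp4"
    by (auto simp: orbit_def)
  then show ?thesis
    by (simp add: carrier_PSp4 image_image PSp4_act_hex_pair[OF assms])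
qed

lemma orbit_hex_image:
  assumes g: "g \<in> carrier Sp4" and x: "x \<in> H_nongen_type3"
  shows "orbit PSp4 PSp4_act_hex (hex_image g x) = orbit PSp4 PSp4_act_hex x"
proof -
  obtain h where h: "h \<in> carrier Sp4" "h ** g = mat 1" using Sp4_inverse[OF g] by blast
  have "(\<lambda>k. hex_image k (hex_image g x)) ` carrier Sp4 \<subseteq> (\<lambda>k. hex_image k x) ` carrier Sp4"
    using g Sp4_mult by (auto simp only: hex_image_mult)
  \<comment> \<open>As \<open>h\<close> inverts \<open>g\<close>, acting by k on x is acting by k h
    on the translate by g.\<close>
  moreover have "hex_image k x = hex_image (k ** h) (hex_image g x)" for k
    by (simp add: hex_image_mult h(2) flip: matrix_mul_assoc)
  then have "(\<lambda>k. hex_image k x) ` carrier Sp4 \<subseteq> (\<lambda>k. hex_image k (hex_image g x)) ` carrier Sp4"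
    using h(1) Sp4_mult by blast
  ultimately show ?thesis
    using g x by (simp add: orbit_PSp4 hex_image_H)
qed

lemma orbit_length_params:
  assumes "x \<in> H_nongen_type3" "y \<in> orbit PSp4 PSp4_act_hex x"
  shows "length_params y = length_params x"
  using assms(2) length_params_hex_image[OF _ assms(1)] unfolding orbit_PSp4[OF assms(1)] by blast

lemma self_mem_orbit:
  assumes "x \<in> H_nongen_type3"
  shows "x \<in> orbit PSp4 PSp4_act_hex x"
  using Sp4_one hex_image_one[of x] by (force simp: orbit_PSp4[OF assms] image_iff)

text \<open>The length parameters determine b, c, d through the logarithm, hence the standard
  hexagon and the orbit; this is the source of injectivity.\<close>

lemma orbit_eq_standard_orbit:
  assumes "x \<in> H_nongen_type3"
  obtains b c d where "b > 1" "c > 1" "d > 1"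
    "orbit PSp4 PSp4_act_hex x = orbit PSp4 PSp4_act_hex (standard_hex b c d)"
    "length_params x = ((ln b, ln b), (ln c, ln c), (ln d, ln d))"
proof -
  obtain g b c d where g: "g \<in> carrier Sp4" "b > 1" "c > 1" "d > 1"
    and e: "hex_image g x = standard_hex b c d"
    using normal_form[OF assms] .
  have "length_params x = ((ln b, ln b), (ln c, ln c), (ln d, ln d))"
    using length_params_hex_image[OF g(1) assms] standard_hex_length_params[of b c d] g by (simp add: e)
  then show ?thesis
    using that[OF g(2-4)] orbit_hex_image[OF g(1) assms] unfolding e by blast
qed

theorem proposition4p22:
  shows "(\<forall>K\<in>carrier PSp4. \<forall>h\<in>H_nongen_type3. PSp4_act_hex K h \<in> H_nongen_type3) \<and>
    (\<exists>F. (\<forall>h\<in>H_nongen_type3. F (orbit PSp4 PSp4_act_hex h) = length_params h) \<and>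
       bij_betw F (orbits PSp4 H_nongen_type3 PSp4_act_hex)
         (diag_chamber \<times> diag_chamber \<times> diag_chamber)) \<and>
    bij_betw (\<lambda>(b, c, d). vector [fst b, fst c, fst d] :: real^3)
      (diag_chamber \<times> diag_chamber \<times> diag_chamber) {v. \<forall>i. v $ i > 0}"
proof (intro conjI)
  show "\<forall>K\<in>carrier PSp4. \<forall>h\<in>H_nongen_type3. PSp4_act_hex K h \<in> H_nongen_type3"
    by (auto simp: carrier_PSp4 PSp4_act_hex_pair hex_image_H)
next
  let ?D = "diag_chamber \<times> diag_chamber \<times> diag_chamber"
  \<comment> \<open>The value is read off an arbitrary representative; it is well defined because
    the length parameters are constant on orbits.\<close>
  define F where "F = (\<lambda>X. length_params (SOME x. x \<in> X))"
  have F: "F (orbit PSp4 PSp4_act_hex x) = length_params x" if "x \<in> H_nongen_type3" for x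
    unfolding F_def using self_mem_orbit[OF that] orbit_length_params[OF that] by (metis someI)
  have "bij_betw F (orbits PSp4 H_nongen_type3 PSp4_act_hex) ?D"
    unfolding bij_betw_def
  proof (intro conjI inj_onI)
    fix X1 X2
    assume "X1 \<in> orbits PSp4 H_nongen_type3 PSp4_act_hex" "X2 \<in> orbits PSp4 H_nongen_type3 PSp4_act_hex"
      and eq: "F X1 = F X2"
    then obtain x1 x2 where x: "x1 \<in> H_nongen_type3" "x2 \<in> H_nongen_type3"
      and X: "X1 = orbit PSp4 PSp4_act_hex x1" "X2 = orbit PSp4 PSp4_act_hex x2"
      by (auto simp: orbits_def)
    obtain b c d where 1: "b > 1" "c > 1" "d > 1"
      "X1 = orbit PSp4 PSp4_act_hex (standard_hex b c d)"
      "length_params x1 = ((ln b, ln b), (ln c, ln c), (ln d, ln d))"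
      using orbit_eq_standard_orbit[OF x(1)] unfolding X by metis
    obtain b' c' d' where 2: "b' > 1" "c' > 1" "d' > 1"
      "X2 = orbit PSp4 PSp4_act_hex (standard_hex b' c' d')"
      "length_params x2 = ((ln b', ln b'), (ln c', ln c'), (ln d', ln d'))"
      using orbit_eq_standard_orbit[OF x(2)] unfolding X by metis
    have "length_params x1 = length_params x2"
      using eq x by (simp add: X F)
    then have "b = b'" "c = c'" "d = d'"
      using 1 2 by simp_all
    then show "X1 = X2" using 1 2 by simp
  next
    show "F ` orbits PSp4 H_nongen_type3 PSp4_act_hex = ?D"
    proof (intro equalityI subsetI)
      fix p assume "p \<in> F ` orbits PSp4 H_nongen_type3 PSp4_act_hex"
      then obtain x where x: "x \<in> H_nongen_type3" "p = length_params x"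
        by (auto simp: orbits_def F)
      obtain b c d where "b > 1" "c > 1" "d > 1"
        "length_params x = ((ln b, ln b), (ln c, ln c), (ln d, ln d))"
        using orbit_eq_standard_orbit[OF x(1)] by metis
      then show "p \<in> ?D" by (simp add: x(2) diag_chamber_def)
    next
      fix p assume "p \<in> ?D"
      then obtain r s t where p: "p = ((r, r), (s, s), (t, t))" and "r > 0" "s > 0" "t > 0"
        by (auto simp: diag_chamber_def)
      \<comment> \<open>Exponentials of positive numbers exceed 1, so they are admissible ratios,
        with logarithms r, s, t.\<close>
      then have "standard_hex (exp r) (exp s) (exp t) \<in> H_nongen_type3"
        "p = length_params (standard_hex (exp r) (exp s) (exp t))"
        by (simp_all add: standard_hex_H standard_hex_length_params)
      then show "p \<in> F ` orbits PSp4 H_nongen_type3 PSp4_act_hex"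
        unfolding orbits_def by (metis (mono_tags, lifting) F image_eqI mem_Collect_eq)
    qed
  qed
  then show "\<exists>F. (\<forall>h\<in>H_nongen_type3. F (orbit PSp4 PSp4_act_hex h) = length_params h) \<and>
      bij_betw F (orbits PSp4 H_nongen_type3 PSp4_act_hex) ?D"
    using F by blast
next
  show "bij_betw (\<lambda>(b, c, d). vector [fst b, fst c, fst d] :: real^3)
      (diag_chamber \<times> diag_chamber \<times> diag_chamber) {v. \<forall>i. v $ i > 0}"
    by (rule bij_betw_byWitness[where f' = "\<lambda>v. ((v $ 1, v $ 1), (v $ 2, v $ 2), (v $ 3, v $ 3))"])
      (auto simp: diag_chamber_def vec_eq_iff forall_3)
qed

end
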